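(* For all program modules $\mathcal P$ and $\mathcal Q$ over $\Sigma$, $\mathcal P\equiv_D\mathcal Q$ if and only if $D(\mathcal P)=D(\mathcal Q)$, where $D(\mathcal P)=\{\mathbf M_{f/n}(\mathcal P)\mid f/n\in FS_\Sigma\}$ is the deletion semantics of $\mathcal P$ and $\mathbf M_{f/n}(\mathcal P)$ is the set of all consistent term models of the set of those rules of $\mathcal P$ that define $f/n$.
   Context: Terms. $\Sigma=(DS_\Sigma,FS_\Sigma)$ consists of countable disjoint sets of constructor symbols and of (defined) function symbols, each with an arity; $DS^n_\Sigma$, $FS^n_\Sigma$ are the symbols of arity $n\ge 0$ ($f/n$ denotes a symbol $f$ of arity $n$). $\mathcal V$ is a countable set of variables; $\bot$ is an extra 0-ary constructor. $\mathbf{Term}_\bot$ is the set of terms over $DS_\Sigma\cup FS_\Sigma\cup\{\bot\}$ and $\mathcal V$; $\mathbf{CTerm}_\bot$ is the subset of terms without function symbols; $\mathbf{Term}$, $\mathbf{CTerm}$ are the respective subsets of terms not containing $\bot$. $\mathbf{CSubst}_\bot$ (resp. $\mathbf{CSubst}$) is the set of maps $\theta:\mathcal V\to\mathbf{CTerm}_\bot$ (resp. $\mathcal V\to\mathbf{CTerm}$), extended to terms and written $t\theta$. Joinability statements are $a\bowtie b$ with $a,b\in\mathbf{Term}_\bot$. $\sqsubseteq$ is the least partial order on $\mathbf{CTerm}_\bot$ with $\bot\sqsubseteq t$ and $c(\overline s)\sqsubseteq c(\overline t)$ whenever $c\in DS^n_\Sigma$ and $s_i\sqsubseteq t_i$ for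 all $i$; $\langle t\rangle=\{s\in\mathbf{CTerm}_\bot\mid s\sqsubseteq t\}$. A cone is a non-empty subset of $\mathbf{CTerm}_\bot$ closed downwards under $\sqsubseteq$. Programs. A program is a set $\mathcal R$ of rules $f(\overline t)\to r\Leftarrow C$ with $f\in FS^n_\Sigma$ (such a rule defines $f$), $\overline t$ an $n$-tuple of terms of $\mathbf{CTerm}$ in which no variable occurs twice, $r\in\mathbf{Term}_\bot$, and $C$ a finite set of joinability statements between terms of $\mathbf{Term}$. $[\mathcal R]_\bot$ is the set of all instances $(l\to r\Leftarrow C)\theta$ of rules of $\mathcal R$ with $\theta\in\mathbf{CSubst}_\bot$. A module $\mathcal P$ is (determined by) a program $rl(\mathcal P)$ whose rules have right-hand sides $r\neq\bot$, together with the set $exp(\mathcal P)$ of function symbols defined by its rules and the set of function symbols that occur but are not defined. For $\sigma\subseteq FS_\Sigma$, $\mathcal P\setminus\sigma$ is the module whose rules are the rules of $\mathcal P$ that define function symbols not in $\sigma$. Term algebras. A (CRWL-)term algebra $\mathcal A$ has carrier $\mathbf{CTerm}_\bot$, interprets each $c\in DS^n_\Sigma$ by $c^{\mathcal A}(\overline t)=\langle c(\overline t)\rangle$, and each $f\in FS^n_\Sigma$ by a monotonic map $f^{\mathcal A}$ from $(\mathbf{CTerm}_\bot)^n$ to cones ordered by inclusion (a cone if $n=0$). $\mathbf{TAlg}_\Sigma$ is the set of them, ordered by $\mathcal A\sqsubseteq\mathcal B$ iff $f^{\mathcal A}(\overline t)\subseteq f^{\mathcal B}(\overline t)$ for all $f,\overline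 t$. $\mathcal A$ is consistent iff $\{u\theta\mid u\in f^{\mathcal A}(\overline t)\}\subseteq f^{\mathcal A}(\overline t\theta)$ for all $f\in FS^n_\Sigma$, $t_i\in\mathbf{CTerm}_\bot$, $\theta\in\mathbf{CSubst}$; $\mathbf{CTAlg}_\Sigma$ is the set of consistent term algebras. Evaluation under a valuation $\eta:\mathcal V\to\mathbf{CTerm}_\bot$: $[\![\bot]\!]^{\mathcal A}_\eta=\langle\bot\rangle$, $[\![X]\!]^{\mathcal A}_\eta=\langle\eta(X)\rangle$, $[\![h(e_1,\dots,e_n)]\!]^{\mathcal A}_\eta=\bigcup\{h^{\mathcal A}(u_1,\dots,u_n)\mid u_i\in[\![e_i]\!]^{\mathcal A}_\eta\}$. $\mathcal A\models_\eta a\to b$ iff $[\![a]\!]^{\mathcal A}_\eta\supseteq[\![b]\!]^{\mathcal A}_\eta$; $\mathcal A\models_\eta a\bowtie b$ iff $[\![a]\!]^{\mathcal A}_\eta\cap[\![b]\!]^{\mathcal A}_\eta$ contains an element of $\mathbf{CTerm}$ (a maximal element); $\mathcal A\models_\eta C$ iff this holds for all statements of $C$. $\mathcal A$ satisfies a rule $l\to r\Leftarrow C$ iff for every valuation $\eta$, $\mathcal A\models_\eta C$ implies $\mathcal A\models_\eta l\to r$; $\mathcal A$ is a term model of a set of rules iff it satisfies all of them. A consistent term model is a term model in $\mathbf{CTAlg}_\Sigma$. $\mathcal T_{\mathcal P}:\mathbf{TAlg}_\Sigma\to\mathbf{TAlg}_\Sigma$ is given by $f^{\mathcal T_{\mathcal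 P}(\mathcal A)}(\overline t)=\{t\mid\exists(f(\overline s)\to r\Leftarrow C)\in[rl(\mathcal P)]_\bot,\ s_i\sqsubseteq t_i\text{ for all }i,\ \mathcal A\models_{id}C,\ t\in[\![r]\!]^{\mathcal A}_{id}\}\cup\{\bot\}$, with $id$ the identity valuation. $\mathcal P\equiv_{CM}\mathcal Q$ iff for all $\mathcal A\in\mathbf{CTAlg}_\Sigma$: $\mathcal T_{\mathcal P}(\mathcal A)\sqsubseteq\mathcal A\Leftrightarrow\mathcal T_{\mathcal Q}(\mathcal A)\sqsubseteq\mathcal A$ (equivalently, $\mathcal P$ and $\mathcal Q$ have the same consistent term models). $\mathcal P\equiv_D\mathcal Q$ iff $\mathcal P\setminus\sigma\equiv_{CM}\mathcal Q\setminus\sigma$ for all $\sigma\subseteq FS_\Sigma$. *)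

theory Defs
  imports Main "HOL-Library.Countable_Set"
begin

section \<open>Signatures and terms\<close>

text \<open>
  Constructor and function symbols live in different types, so that the two sets of symbols
  are disjoint. The variables are all the elements of the type of variables.
\<close>

record ('c, 'f) signature =
  DS :: "'c set"
  FS :: "'f set"
  con_arity :: "'c \<Rightarrow> nat"
  fun_arity :: "'f \<Rightarrow> nat"

definition is_signature :: "('c, 'f) signature \<Rightarrow> bool" where
  "is_signature \<Sigma> \<longleftrightarrow> countable (DS \<Sigma>) \<and> countable (FS \<Sigma>)"

datatype (con_syms: 'c, fun_syms: 'f, vars: 'v) trm =
    Bot
  | Var 'v
  | Con 'c "('c, 'f, 'v) trm list"
  | Fun 'f "('c, 'f, 'v) trm list"

fun wf_term :: "('c, 'f) signature \<Rightarrow> ('c, 'f, 'v) trm \<Rightarrow> bool" where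
  "wf_term \<Sigma> Bot \<longleftrightarrow> True"
| "wf_term \<Sigma> (Var x) \<longleftrightarrow> True"
| "wf_term \<Sigma> (Con c ts) \<longleftrightarrow>
     c \<in> DS \<Sigma> \<and> length ts = con_arity \<Sigma> c \<and> (\<forall>t\<in>set ts. wf_term \<Sigma> t)"
| "wf_term \<Sigma> (Fun f ts) \<longleftrightarrow>
     f \<in> FS \<Sigma> \<and> length ts = fun_arity \<Sigma> f \<and> (\<forall>t\<in>set ts. wf_term \<Sigma> t)"

fun bot_free :: "('c, 'f, 'v) trm \<Rightarrow> bool" where
  "bot_free Bot \<longleftrightarrow> False"
| "bot_free (Var x) \<longleftrightarrow> True"
| "bot_free (Con c ts) \<longleftrightarrow> (\<forall>t\<in>set ts. bot_free t)"
| "bot_free (Fun f ts) \<longleftrightarrow> (\<forall>t\<in>set ts. bot_free t)"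

definition Term_bot :: "('c, 'f) signature \<Rightarrow> ('c, 'f, 'v) trm set" where
  "Term_bot \<Sigma> = {t. wf_term \<Sigma> t}"

definition CTerm_bot :: "('c, 'f) signature \<Rightarrow> ('c, 'f, 'v) trm set" where
  "CTerm_bot \<Sigma> = {t \<in> Term_bot \<Sigma>. fun_syms t = {}}"

definition Term :: "('c, 'f) signature \<Rightarrow> ('c, 'f, 'v) trm set" where
  "Term \<Sigma> = {t \<in> Term_bot \<Sigma>. bot_free t}"

definition CTerm :: "('c, 'f) signature \<Rightarrow> ('c, 'f, 'v) trm set" where
  "CTerm \<Sigma> = {t \<in> CTerm_bot \<Sigma>. bot_free t}"

definition CTuples_bot :: "('c, 'f) signature \<Rightarrow> nat \<Rightarrow> ('c, 'f, 'v) trm list set" where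
  "CTuples_bot \<Sigma> n = {ts. length ts = n \<and> set ts \<subseteq> CTerm_bot \<Sigma>}"

definition CSubst_bot :: "('c, 'f) signature \<Rightarrow> ('v \<Rightarrow> ('c, 'f, 'v) trm) set" where
  "CSubst_bot \<Sigma> = {\<theta>. \<forall>x. \<theta> x \<in> CTerm_bot \<Sigma>}"

definition CSubst :: "('c, 'f) signature \<Rightarrow> ('v \<Rightarrow> ('c, 'f, 'v) trm) set" where
  "CSubst \<Sigma> = {\<theta>. \<forall>x. \<theta> x \<in> CTerm \<Sigma>}"

fun subst :: "('v \<Rightarrow> ('c, 'f, 'v) trm) \<Rightarrow> ('c, 'f, 'v) trm \<Rightarrow> ('c, 'f, 'v) trm" where
  "subst \<theta> Bot = Bot"
| "subst \<theta> (Var x) = \<theta> x"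
| "subst \<theta> (Con c ts) = Con c (map (subst \<theta>) ts)"
| "subst \<theta> (Fun f ts) = Fun f (map (subst \<theta>) ts)"

fun var_occs :: "('c, 'f, 'v) trm \<Rightarrow> 'v list" where
  "var_occs Bot = []"
| "var_occs (Var x) = [x]"
| "var_occs (Con c ts) = concat (map var_occs ts)"
| "var_occs (Fun f ts) = concat (map var_occs ts)"

section \<open>The approximation order\<close>

text \<open>
  The least reflexive and transitive relation on partial constructor terms with the two required
  closure properties. It is antisymmetric (see below), hence the least such partial order.
\<close>

inductive approx ::
  "('c, 'f) signature \<Rightarrow> ('c, 'f, 'v) trm \<Rightarrow> ('c, 'f, 'v) trm \<Rightarrow> bool" for \<Sigma> where
  refl: "t \<in> CTerm_bot \<Sigma> \<Longrightarrow> approx \<Sigma> t t"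
| trans: "approx \<Sigma> s t \<Longrightarrow> approx \<Sigma> t u \<Longrightarrow> approx \<Sigma> s u"
| bot: "t \<in> CTerm_bot \<Sigma> \<Longrightarrow> approx \<Sigma> Bot t"
| con: "c \<in> DS \<Sigma> \<Longrightarrow> length ss = con_arity \<Sigma> c \<Longrightarrow> list_all2 (approx \<Sigma>) ss ts \<Longrightarrow>
    approx \<Sigma> (Con c ss) (Con c ts)"

lemma approx_CTerm_bot:
  assumes "approx \<Sigma> s t"
  shows "s \<in> CTerm_bot \<Sigma>" "t \<in> CTerm_bot \<Sigma>"
proof -
  have "s \<in> CTerm_bot \<Sigma> \<and> t \<in> CTerm_bot \<Sigma>"
    using assms
    by (induction rule: approx.induct)
      (auto simp: CTerm_bot_def Term_bot_def list_all2_conv_all_nth set_conv_nth)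
  then show "s \<in> CTerm_bot \<Sigma>" "t \<in> CTerm_bot \<Sigma>" by auto
qed

lemma approx_inversion:
  assumes "approx \<Sigma> s t"
  shows "s = Bot \<or> s = t \<or>
    (\<exists>c ss ts. s = Con c ss \<and> t = Con c ts \<and> list_all2 (approx \<Sigma>) ss ts)"
  using assms
proof (induction rule: approx.induct)
  case (trans s t u)
  have "list_all2 (approx \<Sigma>) xs zs"
    if "list_all2 (approx \<Sigma>) xs ys" "list_all2 (approx \<Sigma>) ys zs" for xs ys zs
    using list_all2_trans[OF approx.trans that] .
  then show ?case using trans.IH by (elim disjE exE conjE) blast+
next
  case (con c ss ts)
  then show ?case by (simp add: list_all2_conv_all_nth)
qed auto

lemma approx_antisym: "approx \<Sigma> s t \<Longrightarrow> approx \<Sigma> t s \<Longrightarrow> s = t"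
proof (induction s arbitrary: t)
  case (Con c ss)
  from approx_inversion[OF Con.prems(1)] show ?case
  proof (elim disjE exE conjE)
    fix d us ts
    assume *: "Con c ss = Con d us" "t = Con d ts" "list_all2 (approx \<Sigma>) us ts"
    from approx_inversion[OF Con.prems(2)] *
    have "list_all2 (approx \<Sigma>) ts ss \<or> ts = ss" by auto
    with * Con.IH have "ss = ts"
      by (auto simp: list_all2_conv_all_nth intro!: nth_equalityI)
    with * show ?thesis by simp
  qed auto
qed (use approx_inversion in fastforce)+

lemma partial_order_on_approx:
  "partial_order_on (CTerm_bot \<Sigma>) {(s, t). approx \<Sigma> s t}"
  unfolding partial_order_on_def preorder_on_def
  by (auto simp: refl_on_def trans_def antisym_def
      intro: approx.refl approx.trans approx_antisym dest: approx_CTerm_bot)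

definition down :: "('c, 'f) signature \<Rightarrow> ('c, 'f, 'v) trm \<Rightarrow> ('c, 'f, 'v) trm set" where
  "down \<Sigma> t = {s \<in> CTerm_bot \<Sigma>. approx \<Sigma> s t}"

definition is_cone :: "('c, 'f) signature \<Rightarrow> ('c, 'f, 'v) trm set \<Rightarrow> bool" where
  "is_cone \<Sigma> K \<longleftrightarrow> K \<noteq> {} \<and> K \<subseteq> CTerm_bot \<Sigma> \<and>
     (\<forall>t\<in>K. \<forall>s\<in>CTerm_bot \<Sigma>. approx \<Sigma> s t \<longrightarrow> s \<in> K)"

section \<open>Programs and modules\<close>

text \<open>A joinability statement is the pair of its two sides.\<close>

type_synonym ('c, 'f, 'v) joinability = "('c, 'f, 'v) trm \<times> ('c, 'f, 'v) trm"

datatype ('c, 'f, 'v) rule =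
  Rule (head: 'f) (args: "('c, 'f, 'v) trm list") (rhs: "('c, 'f, 'v) trm")
    (conds: "('c, 'f, 'v) joinability set")

definition is_rule :: "('c, 'f) signature \<Rightarrow> ('c, 'f, 'v) rule \<Rightarrow> bool" where
  "is_rule \<Sigma> \<rho> \<longleftrightarrow>
     head \<rho> \<in> FS \<Sigma> \<and>
     length (args \<rho>) = fun_arity \<Sigma> (head \<rho>) \<and> set (args \<rho>) \<subseteq> CTerm \<Sigma> \<and>
     distinct (concat (map var_occs (args \<rho>))) \<and>
     rhs \<rho> \<in> Term_bot \<Sigma> \<and>
     finite (conds \<rho>) \<and> conds \<rho> \<subseteq> Term \<Sigma> \<times> Term \<Sigma>"

definition is_program :: "('c, 'f) signature \<Rightarrow> ('c, 'f, 'v) rule set \<Rightarrow> bool" where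
  "is_program \<Sigma> R \<longleftrightarrow> (\<forall>\<rho>\<in>R. is_rule \<Sigma> \<rho>)"

text \<open>
  A module is identified with its set of rules, which determines its exported symbols
  and its symbols that occur without being defined.
\<close>

definition is_module :: "('c, 'f) signature \<Rightarrow> ('c, 'f, 'v) rule set \<Rightarrow> bool" where
  "is_module \<Sigma> P \<longleftrightarrow> is_program \<Sigma> P \<and> (\<forall>\<rho>\<in>P. rhs \<rho> \<noteq> Bot)"

definition delete :: "('c, 'f, 'v) rule set \<Rightarrow> 'f set \<Rightarrow> ('c, 'f, 'v) rule set" where
  "delete P \<sigma> = {\<rho> \<in> P. head \<rho> \<notin> \<sigma>}"

definition defining_rules :: "('c, 'f, 'v) rule set \<Rightarrow> 'f \<Rightarrow> ('c, 'f, 'v) rule set" where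
  "defining_rules P f = {\<rho> \<in> P. head \<rho> = f}"

fun subst_rule :: "('v \<Rightarrow> ('c, 'f, 'v) trm) \<Rightarrow> ('c, 'f, 'v) rule \<Rightarrow> ('c, 'f, 'v) rule" where
  "subst_rule \<theta> (Rule f ts r C) =
     Rule f (map (subst \<theta>) ts) (subst \<theta> r) ((\<lambda>(a, b). (subst \<theta> a, subst \<theta> b)) ` C)"

definition instances ::
  "('c, 'f) signature \<Rightarrow> ('c, 'f, 'v) rule set \<Rightarrow> ('c, 'f, 'v) rule set" where
  "instances \<Sigma> R = {subst_rule \<theta> \<rho> | \<theta> \<rho>. \<theta> \<in> CSubst_bot \<Sigma> \<and> \<rho> \<in> R}"

section \<open>Term algebras\<close>

text \<open>
  The carrier and the interpretation of the constructors are the same in all term algebras, so a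
  term algebra is given by its interpretation of the function symbols. To make this representation
  unique, the interpretation is the empty set (which is not a cone) outside of its domain.
\<close>

type_synonym ('c, 'f, 'v) interp = "'f \<Rightarrow> ('c, 'f, 'v) trm list \<Rightarrow> ('c, 'f, 'v) trm set"

definition con_interp ::
  "('c, 'f) signature \<Rightarrow> 'c \<Rightarrow> ('c, 'f, 'v) trm list \<Rightarrow> ('c, 'f, 'v) trm set" where
  "con_interp \<Sigma> c ts = down \<Sigma> (Con c ts)"

definition TAlg :: "('c, 'f) signature \<Rightarrow> ('c, 'f, 'v) interp set" where
  "TAlg \<Sigma> = {A.
     (\<forall>f\<in>FS \<Sigma>. \<forall>ts\<in>CTuples_bot \<Sigma> (fun_arity \<Sigma> f). is_cone \<Sigma> (A f ts)) \<and>
     (\<forall>f\<in>FS \<Sigma>. \<forall>ss\<in>CTuples_bot \<Sigma> (fun_arity \<Sigma> f). \<forall>ts\<in>CTuples_bot \<Sigma> (fun_arity \<Sigma> f).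
        list_all2 (approx \<Sigma>) ss ts \<longrightarrow> A f ss \<subseteq> A f ts) \<and>
     (\<forall>f ts. \<not> (f \<in> FS \<Sigma> \<and> ts \<in> CTuples_bot \<Sigma> (fun_arity \<Sigma> f)) \<longrightarrow> A f ts = {})}"

definition alg_le ::
  "('c, 'f) signature \<Rightarrow> ('c, 'f, 'v) interp \<Rightarrow> ('c, 'f, 'v) interp \<Rightarrow> bool" where
  "alg_le \<Sigma> A B \<longleftrightarrow>
     (\<forall>f\<in>FS \<Sigma>. \<forall>ts\<in>CTuples_bot \<Sigma> (fun_arity \<Sigma> f). A f ts \<subseteq> B f ts)"

definition consistent :: "('c, 'f) signature \<Rightarrow> ('c, 'f, 'v) interp \<Rightarrow> bool" where
  "consistent \<Sigma> A \<longleftrightarrow>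
     (\<forall>f\<in>FS \<Sigma>. \<forall>ts\<in>CTuples_bot \<Sigma> (fun_arity \<Sigma> f). \<forall>\<theta>\<in>CSubst \<Sigma>.
        {subst \<theta> u | u. u \<in> A f ts} \<subseteq> A f (map (subst \<theta>) ts))"

definition CTAlg :: "('c, 'f) signature \<Rightarrow> ('c, 'f, 'v) interp set" where
  "CTAlg \<Sigma> = {A \<in> TAlg \<Sigma>. consistent \<Sigma> A}"

text \<open>A valuation is an element of \<^term>\<open>CSubst_bot \<Sigma>\<close>; the identity valuation is \<^term>\<open>Var\<close>.\<close>

fun eval :: "('c, 'f) signature \<Rightarrow> ('c, 'f, 'v) interp \<Rightarrow> ('v \<Rightarrow> ('c, 'f, 'v) trm) \<Rightarrow>
    ('c, 'f, 'v) trm \<Rightarrow> ('c, 'f, 'v) trm set" where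
  "eval \<Sigma> A \<eta> Bot = down \<Sigma> Bot"
| "eval \<Sigma> A \<eta> (Var x) = down \<Sigma> (\<eta> x)"
| "eval \<Sigma> A \<eta> (Con c es) =
     \<Union>{con_interp \<Sigma> c us | us. list_all2 (\<lambda>u e. u \<in> eval \<Sigma> A \<eta> e) us es}"
| "eval \<Sigma> A \<eta> (Fun f es) =
     \<Union>{A f us | us. list_all2 (\<lambda>u e. u \<in> eval \<Sigma> A \<eta> e) us es}"

definition sat_reduction :: "('c, 'f) signature \<Rightarrow> ('c, 'f, 'v) interp \<Rightarrow>
    ('v \<Rightarrow> ('c, 'f, 'v) trm) \<Rightarrow> ('c, 'f, 'v) trm \<Rightarrow> ('c, 'f, 'v) trm \<Rightarrow> bool" where
  "sat_reduction \<Sigma> A \<eta> a b \<longleftrightarrow> eval \<Sigma> A \<eta> a \<supseteq> eval \<Sigma> A \<eta> b"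

definition sat_join :: "('c, 'f) signature \<Rightarrow> ('c, 'f, 'v) interp \<Rightarrow>
    ('v \<Rightarrow> ('c, 'f, 'v) trm) \<Rightarrow> ('c, 'f, 'v) trm \<Rightarrow> ('c, 'f, 'v) trm \<Rightarrow> bool" where
  "sat_join \<Sigma> A \<eta> a b \<longleftrightarrow> (\<exists>t \<in> eval \<Sigma> A \<eta> a \<inter> eval \<Sigma> A \<eta> b. t \<in> CTerm \<Sigma>)"

definition sat_conds :: "('c, 'f) signature \<Rightarrow> ('c, 'f, 'v) interp \<Rightarrow>
    ('v \<Rightarrow> ('c, 'f, 'v) trm) \<Rightarrow> ('c, 'f, 'v) joinability set \<Rightarrow> bool" where
  "sat_conds \<Sigma> A \<eta> C \<longleftrightarrow> (\<forall>(a, b)\<in>C. sat_join \<Sigma> A \<eta> a b)"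

definition sat_rule ::
  "('c, 'f) signature \<Rightarrow> ('c, 'f, 'v) interp \<Rightarrow> ('c, 'f, 'v) rule \<Rightarrow> bool" where
  "sat_rule \<Sigma> A \<rho> \<longleftrightarrow>
     (\<forall>\<eta>\<in>CSubst_bot \<Sigma>. sat_conds \<Sigma> A \<eta> (conds \<rho>) \<longrightarrow>
        sat_reduction \<Sigma> A \<eta> (Fun (head \<rho>) (args \<rho>)) (rhs \<rho>))"

definition term_model ::
  "('c, 'f) signature \<Rightarrow> ('c, 'f, 'v) rule set \<Rightarrow> ('c, 'f, 'v) interp \<Rightarrow> bool" where
  "term_model \<Sigma> R A \<longleftrightarrow> A \<in> TAlg \<Sigma> \<and> (\<forall>\<rho>\<in>R. sat_rule \<Sigma> A \<rho>)"

section \<open>The two equivalences and the deletion semantics\<close>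

definition T_op :: "('c, 'f) signature \<Rightarrow> ('c, 'f, 'v) rule set \<Rightarrow>
    ('c, 'f, 'v) interp \<Rightarrow> ('c, 'f, 'v) interp" where
  "T_op \<Sigma> P A f ts =
     (if f \<in> FS \<Sigma> \<and> ts \<in> CTuples_bot \<Sigma> (fun_arity \<Sigma> f) then
        {t. \<exists>ss r C. Rule f ss r C \<in> instances \<Sigma> P \<and> list_all2 (approx \<Sigma>) ss ts \<and>
              sat_conds \<Sigma> A Var C \<and> t \<in> eval \<Sigma> A Var r} \<union> {Bot}
      else {})"

definition equiv_CM ::
  "('c, 'f) signature \<Rightarrow> ('c, 'f, 'v) rule set \<Rightarrow> ('c, 'f, 'v) rule set \<Rightarrow> bool" where
  "equiv_CM \<Sigma> P Q \<longleftrightarrow>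
     (\<forall>A\<in>CTAlg \<Sigma>. alg_le \<Sigma> (T_op \<Sigma> P A) A \<longleftrightarrow> alg_le \<Sigma> (T_op \<Sigma> Q A) A)"

definition equiv_D ::
  "('c, 'f) signature \<Rightarrow> ('c, 'f, 'v) rule set \<Rightarrow> ('c, 'f, 'v) rule set \<Rightarrow> bool" where
  "equiv_D \<Sigma> P Q \<longleftrightarrow> (\<forall>\<sigma>. \<sigma> \<subseteq> FS \<Sigma> \<longrightarrow> equiv_CM \<Sigma> (delete P \<sigma>) (delete Q \<sigma>))"

definition M_sem ::
  "('c, 'f) signature \<Rightarrow> 'f \<Rightarrow> ('c, 'f, 'v) rule set \<Rightarrow> ('c, 'f, 'v) interp set" where
  "M_sem \<Sigma> f P = {A \<in> CTAlg \<Sigma>. term_model \<Sigma> (defining_rules P f) A}"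

definition deletion_semantics ::
  "('c, 'f) signature \<Rightarrow> ('c, 'f, 'v) rule set \<Rightarrow> ('c, 'f, 'v) interp set set" where
  "deletion_semantics \<Sigma> P = {M_sem \<Sigma> f P | f. f \<in> FS \<Sigma>}"

end

(*
  A consistent term algebra is a pre-fixpoint of T_P iff it satisfies every rule of P, and each rule
  only bounds the interpretation of its head symbol from below. Hence the deletion equivalence says
  that the model classes of P and Q agree symbol by symbol. The deletion semantics does not record
  which symbol a model class belongs to; this loses nothing, because a class that arises from two
  different symbols f and g contains every consistent term algebra: enlarging the interpretation of f
  to the whole carrier satisfies all rules for f, hence those for g, and by monotonicity of
  evaluation the rules for g then already hold in the original algebra.
*)
theory Submission
  imports Defs
begin

section \<open>Substitutions, cones and term algebras\<close>

lemma subst_CTerm_bot: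
  assumes "t \<in> CTerm_bot \<Sigma>" "\<theta> \<in> CSubst_bot \<Sigma>"
  shows "subst \<theta> t \<in> CTerm_bot \<Sigma>"
  using assms
  by (induction t) (auto simp: CTerm_bot_def Term_bot_def CSubst_bot_def)

lemma CTerm_subset_CTerm_bot: "CTerm \<Sigma> \<subseteq> CTerm_bot \<Sigma>"
  by (auto simp: CTerm_def)

lemma CSubst_subset_CSubst_bot: "CSubst \<Sigma> \<subseteq> CSubst_bot \<Sigma>"
  by (auto simp: CSubst_def CSubst_bot_def CTerm_def)

lemma map_subst_CTuples_bot:
  assumes "ts \<in> CTuples_bot \<Sigma> n" "\<theta> \<in> CSubst_bot \<Sigma>"
  shows "map (subst \<theta>) ts \<in> CTuples_bot \<Sigma> n"
  using assms by (auto simp: CTuples_bot_def intro: subst_CTerm_bot)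

lemma TAlg_outside:
  "A \<in> TAlg \<Sigma> \<Longrightarrow> \<not> (f \<in> FS \<Sigma> \<and> ts \<in> CTuples_bot \<Sigma> (fun_arity \<Sigma> f)) \<Longrightarrow> A f ts = {}"
  unfolding TAlg_def by blast

lemma TAlg_mono:
  "A \<in> TAlg \<Sigma> \<Longrightarrow> f \<in> FS \<Sigma> \<Longrightarrow> ss \<in> CTuples_bot \<Sigma> (fun_arity \<Sigma> f) \<Longrightarrow>
    ts \<in> CTuples_bot \<Sigma> (fun_arity \<Sigma> f) \<Longrightarrow> list_all2 (approx \<Sigma>) ss ts \<Longrightarrow> A f ss \<subseteq> A f ts"
  unfolding TAlg_def by blast

lemma TAlg_cone:
  "A \<in> TAlg \<Sigma> \<Longrightarrow> f \<in> FS \<Sigma> \<Longrightarrow> ts \<in> CTuples_bot \<Sigma> (fun_arity \<Sigma> f) \<Longrightarrow> is_cone \<Sigma> (A f ts)"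
  unfolding TAlg_def by blast

lemma is_cone_subset: "is_cone \<Sigma> K \<Longrightarrow> K \<subseteq> CTerm_bot \<Sigma>"
  by (simp add: is_cone_def)

text \<open>On the domain the value is a cone; elsewhere the encoding of term algebras makes it
  empty.\<close>

lemma TAlg_subset_CTerm_bot: "A \<in> TAlg \<Sigma> \<Longrightarrow> A f ts \<subseteq> CTerm_bot \<Sigma>"
  using TAlg_outside TAlg_cone is_cone_subset by fastforce

lemma Bot_CTerm_bot [simp]: "Bot \<in> CTerm_bot \<Sigma>"
  by (simp add: CTerm_bot_def Term_bot_def)

lemma Bot_in_cone: "is_cone \<Sigma> K \<Longrightarrow> Bot \<in> K"
  unfolding is_cone_def by (meson Bot_CTerm_bot all_not_in_conv approx.bot subsetD)

lemma CTuples_bot_approx_refl: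
  "ts \<in> CTuples_bot \<Sigma> n \<Longrightarrow> list_all2 (approx \<Sigma>) ts ts"
  by (auto simp: CTuples_bot_def intro!: list.rel_refl_strong approx.refl)

lemma approx_CTuples_bot:
  assumes "list_all2 (approx \<Sigma>) ss ts" "ts \<in> CTuples_bot \<Sigma> n"
  shows "ss \<in> CTuples_bot \<Sigma> n"
proof -
  have "set ss \<subseteq> CTerm_bot \<Sigma>"
    using assms(1) by (induction rule: list_all2_induct) (auto dest: approx_CTerm_bot)
  then show ?thesis
    using assms list_all2_lengthD[OF assms(1)] by (simp add: CTuples_bot_def)
qed

section \<open>Evaluation of terms\<close>

lemma in_down: "s \<in> down \<Sigma> t \<longleftrightarrow> approx \<Sigma> s t"
  by (auto simp: down_def dest: approx_CTerm_bot)

lemma eval_subset_CTerm_bot: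
  assumes "A \<in> TAlg \<Sigma>"
  shows "eval \<Sigma> A \<eta> e \<subseteq> CTerm_bot \<Sigma>"
  \<comment> \<open>A case split suffices: the value of any term is a union of down-sets or of
    values of \<open>A\<close>, whatever the subterms evaluate to.\<close>
  using TAlg_subset_CTerm_bot[OF assms]
  by (cases e) (auto simp: con_interp_def down_def)

text \<open>By induction the arguments evaluate to down-sets, so the union for
  \<open>Con c es\<close> ranges over the tuples below \<open>?es\<close>. The tuple
  \<open>?es\<close> is itself one of them, and since constructors are monotonic it contributes the
  largest down-set.\<close>

lemma eval_CTerm_bot:
  assumes "t \<in> CTerm_bot \<Sigma>" "\<eta> \<in> CSubst_bot \<Sigma>"
  shows "eval \<Sigma> A \<eta> t = down \<Sigma> (subst \<eta> t)"
  using assms(1)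
proof (induction t)
  case (Con c es)
  let ?es = "map (subst \<eta>) es"
  have es: "e \<in> CTerm_bot \<Sigma>" if "e \<in> set es" for e
    using Con.prems that by (auto simp: CTerm_bot_def Term_bot_def)
  have c: "c \<in> DS \<Sigma>" "length es = con_arity \<Sigma> c"
    using Con.prems by (auto simp: CTerm_bot_def Term_bot_def)
  have args: "list_all2 (\<lambda>u e. u \<in> eval \<Sigma> A \<eta> e) us es \<longleftrightarrow> list_all2 (approx \<Sigma>) us ?es" for us
    using Con.IH es by (auto simp: list_all2_conv_all_nth in_down)
  have "list_all2 (approx \<Sigma>) ?es ?es"
    using es assms(2) by (auto simp: list_all2_conv_all_nth intro!: approx.refl subst_CTerm_bot)
  moreover have "approx \<Sigma> (Con c us) (Con c ?es)" if "list_all2 (approx \<Sigma>) us ?es" for us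
    using that c by (intro approx.con) (auto dest: list_all2_lengthD)
  ultimately show ?case
    by (auto simp: args con_interp_def in_down) (blast intro: approx.trans)+
qed (auto simp: CTerm_bot_def Term_bot_def)

text \<open>This is the bridge between \<open>T_op\<close>, which evaluates instances under the
  identity valuation, and \<open>sat_rule\<close>, which evaluates the rules themselves under all
  valuations.\<close>

lemma eval_subst:
  fixes \<theta> :: "'v \<Rightarrow> ('c, 'f, 'v) trm"
  assumes "\<theta> \<in> CSubst_bot \<Sigma>"
  shows "eval \<Sigma> A Var (subst \<theta> e) = eval \<Sigma> A \<theta> e"
proof (induction e)
  \<comment> \<open>The only case with content: \<open>\<theta> x\<close> is a constructor term, so
    evaluating it under \<open>Var\<close> gives its own down-set.\<close>
  case (Var x)
  have "(Var :: 'v \<Rightarrow> ('c, 'f, 'v) trm) \<in> CSubst_bot \<Sigma>"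
    by (simp add: CSubst_bot_def CTerm_bot_def Term_bot_def)
  moreover have "subst Var t = t" for t :: "('c, 'f, 'v) trm"
    by (induction t) (auto intro: map_idI)
  moreover have "\<theta> x \<in> CTerm_bot \<Sigma>"
    using assms by (simp add: CSubst_bot_def)
  ultimately show ?case
    by (simp add: eval_CTerm_bot)
next
  case (Con c es)
  then have "list_all2 (\<lambda>u e. u \<in> eval \<Sigma> A Var e) us (map (subst \<theta>) es) \<longleftrightarrow>
      list_all2 (\<lambda>u e. u \<in> eval \<Sigma> A \<theta> e) us es" for us
    by (auto simp: list_all2_conv_all_nth)
  then show ?case by simp
next
  case (Fun f es)
  then have "list_all2 (\<lambda>u e. u \<in> eval \<Sigma> A Var e) us (map (subst \<theta>) es) \<longleftrightarrow>
      list_all2 (\<lambda>u e. u \<in> eval \<Sigma> A \<theta> e) us es" for us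
    by (auto simp: list_all2_conv_all_nth)
  then show ?case by simp
qed simp

lemma sat_conds_subst:
  assumes "\<theta> \<in> CSubst_bot \<Sigma>"
  shows "sat_conds \<Sigma> A Var ((\<lambda>(a, b). (subst \<theta> a, subst \<theta> b)) ` C) = sat_conds \<Sigma> A \<theta> C"
  by (simp add: sat_conds_def sat_join_def eval_subst[OF assms] split_beta)

text \<open>In the \<open>Fun\<close> case a larger algebra enlarges both the set of argument tuples
  in the union and the contribution of each tuple.\<close>

lemma eval_mono:
  assumes "\<And>f ts. A f ts \<subseteq> B f ts"
  shows "eval \<Sigma> A \<eta> e \<subseteq> eval \<Sigma> B \<eta> e"
proof (induction e)
  case (Con c es)
  have "list_all2 (\<lambda>u e. u \<in> eval \<Sigma> B \<eta> e) us es"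
    if "list_all2 (\<lambda>u e. u \<in> eval \<Sigma> A \<eta> e) us es" for us
    by (rule list.rel_mono_strong[OF that]) (use Con.IH in blast)
  then show ?case unfolding eval.simps by blast
next
  case (Fun f es)
  have "list_all2 (\<lambda>u e. u \<in> eval \<Sigma> B \<eta> e) us es"
    if "list_all2 (\<lambda>u e. u \<in> eval \<Sigma> A \<eta> e) us es" for us
    by (rule list.rel_mono_strong[OF that]) (use Fun.IH in blast)
  then show ?case using assms unfolding eval.simps by blast
qed auto

text \<open>A joinability statement only asks for a common total value, and such a value survives
  when both sides grow.\<close>

lemma sat_conds_mono:
  assumes "\<And>f ts. A f ts \<subseteq> B f ts" "sat_conds \<Sigma> A \<eta> C"
  shows "sat_conds \<Sigma> B \<eta> C"
proof -
  have "sat_join \<Sigma> B \<eta> a b" if "sat_join \<Sigma> A \<eta> a b" for a b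
    using that eval_mono[of A B \<Sigma> \<eta> a] eval_mono[of A B \<Sigma> \<eta> b] assms(1)
    unfolding sat_join_def by blast
  then show ?thesis
    using assms(2) unfolding sat_conds_def by blast
qed

section \<open>Models of rules as pre-fixpoints of \<open>T_op\<close>\<close>

lemma is_rule_args:
  "is_rule \<Sigma> \<rho> \<Longrightarrow> args \<rho> \<in> CTuples_bot \<Sigma> (fun_arity \<Sigma> (head \<rho>))"
  using CTerm_subset_CTerm_bot[of \<Sigma>] unfolding is_rule_def CTuples_bot_def by blast

text \<open>The arguments evaluate to down-sets, and monotonicity of \<open>A f\<close> lets the
  greatest tuple \<open>?ts\<close> absorb all others in the union.\<close>

lemma eval_Fun_CTuples_bot:
  assumes A: "A \<in> TAlg \<Sigma>" and f: "f \<in> FS \<Sigma>"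
    and ts: "ts \<in> CTuples_bot \<Sigma> (fun_arity \<Sigma> f)" and \<eta>: "\<eta> \<in> CSubst_bot \<Sigma>"
  shows "eval \<Sigma> A \<eta> (Fun f ts) = A f (map (subst \<eta>) ts)"
proof -
  let ?ts = "map (subst \<eta>) ts"
  have ts': "?ts \<in> CTuples_bot \<Sigma> (fun_arity \<Sigma> f)"
    using map_subst_CTuples_bot[OF ts \<eta>] .
  have "list_all2 (\<lambda>u e. u \<in> eval \<Sigma> A \<eta> e) us ts \<longleftrightarrow> list_all2 (approx \<Sigma>) us ?ts" for us
    using ts \<eta> by (auto simp: list_all2_conv_all_nth CTuples_bot_def eval_CTerm_bot in_down
        subset_iff)
  moreover have "list_all2 (approx \<Sigma>) ?ts ?ts"
    using CTuples_bot_approx_refl[OF ts'] .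
  moreover have "A f us \<subseteq> A f ?ts" if "list_all2 (approx \<Sigma>) us ?ts" for us
  proof -
    have "us \<in> CTuples_bot \<Sigma> (fun_arity \<Sigma> f)"
      using that ts' by (rule approx_CTuples_bot)
    then show ?thesis using TAlg_mono[OF A f _ ts' that] by blast
  qed
  ultimately show ?thesis by auto
qed

text \<open>Arguments of a left-hand side are constructor terms, so the left-hand side evaluates to
  a single value of the head symbol. In this form a rule is visibly a lower bound on its head
  alone.\<close>

lemma sat_rule_iff:
  assumes "A \<in> TAlg \<Sigma>" "is_rule \<Sigma> \<rho>"
  shows "sat_rule \<Sigma> A \<rho> \<longleftrightarrow> (\<forall>\<eta>\<in>CSubst_bot \<Sigma>. sat_conds \<Sigma> A \<eta> (conds \<rho>) \<longrightarrow>
    eval \<Sigma> A \<eta> (rhs \<rho>) \<subseteq> A (head \<rho>) (map (subst \<eta>) (args \<rho>)))"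
proof -
  have "head \<rho> \<in> FS \<Sigma>"
    using assms(2) by (simp add: is_rule_def)
  from eval_Fun_CTuples_bot[OF assms(1) this is_rule_args[OF assms(2)]]
  show ?thesis
    unfolding sat_rule_def sat_reduction_def by simp
qed

text \<open>Instances and valuations correspond by \<open>eval_subst\<close>. What
  \<open>T_op\<close> adds beyond the rules is harmless: monotonicity of \<open>A\<close> covers
  matching up to approximation, and every cone contains \<open>Bot\<close>.\<close>

lemma T_op_le_iff:
  assumes A: "A \<in> TAlg \<Sigma>" and R: "is_program \<Sigma> R"
  shows "alg_le \<Sigma> (T_op \<Sigma> R A) A \<longleftrightarrow> term_model \<Sigma> R A"
proof
  assume le: "alg_le \<Sigma> (T_op \<Sigma> R A) A"
  have "sat_rule \<Sigma> A \<rho>" if \<rho>: "\<rho> \<in> R" for \<rho>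
  proof -
    have rule: "is_rule \<Sigma> \<rho>" using R \<rho> by (simp add: is_program_def)
    then have f: "head \<rho> \<in> FS \<Sigma>" by (simp add: is_rule_def)
    have "eval \<Sigma> A \<eta> (rhs \<rho>) \<subseteq> A (head \<rho>) (map (subst \<eta>) (args \<rho>))"
      if \<eta>: "\<eta> \<in> CSubst_bot \<Sigma>" and C: "sat_conds \<Sigma> A \<eta> (conds \<rho>)" for \<eta>
    proof -
      let ?ss = "map (subst \<eta>) (args \<rho>)"
      have ss: "?ss \<in> CTuples_bot \<Sigma> (fun_arity \<Sigma> (head \<rho>))"
        using map_subst_CTuples_bot[OF is_rule_args[OF rule] \<eta>] .
      \<comment> \<open>The instance by \<open>\<eta>\<close> is used at its own argument tuple, so
        that matching is reflexivity.\<close>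
      have "subst_rule \<eta> \<rho> \<in> instances \<Sigma> R"
        using \<rho> \<eta> by (auto simp: instances_def)
      then have "Rule (head \<rho>) ?ss (subst \<eta> (rhs \<rho>))
          ((\<lambda>(a, b). (subst \<eta> a, subst \<eta> b)) ` conds \<rho>) \<in> instances \<Sigma> R"
        by (cases \<rho>) simp
      moreover have "list_all2 (approx \<Sigma>) ?ss ?ss"
        using CTuples_bot_approx_refl[OF ss] .
      ultimately have "eval \<Sigma> A Var (subst \<eta> (rhs \<rho>)) \<subseteq> T_op \<Sigma> R A (head \<rho>) ?ss"
        using f ss C unfolding T_op_def sat_conds_subst[OF \<eta>, symmetric] by auto
      also have "\<dots> \<subseteq> A (head \<rho>) ?ss"
        using le f ss by (simp add: alg_le_def)
      finally show ?thesis by (simp add: eval_subst[OF \<eta>])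
    qed
    then show ?thesis using sat_rule_iff[OF A rule] by blast
  qed
  then show "term_model \<Sigma> R A" using A by (simp add: term_model_def)
next
  assume model: "term_model \<Sigma> R A"
  show "alg_le \<Sigma> (T_op \<Sigma> R A) A"
    unfolding alg_le_def
  proof (intro ballI subsetI)
    fix f ts t
    assume f: "f \<in> FS \<Sigma>" and ts: "ts \<in> CTuples_bot \<Sigma> (fun_arity \<Sigma> f)"
      and t: "t \<in> T_op \<Sigma> R A f ts"
    show "t \<in> A f ts"
    proof (cases "t = Bot")
      case True
      then show ?thesis using Bot_in_cone TAlg_cone[OF A f ts] by blast
    next
      case False
      with f ts t obtain ss r C where inst: "Rule f ss r C \<in> instances \<Sigma> R"
        and le: "list_all2 (approx \<Sigma>) ss ts" and C: "sat_conds \<Sigma> A Var C"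
        and t: "t \<in> eval \<Sigma> A Var r"
        by (auto simp: T_op_def)
      from inst obtain \<theta> \<rho> where \<theta>: "\<theta> \<in> CSubst_bot \<Sigma>" and \<rho>: "\<rho> \<in> R"
        and eq: "Rule f ss r C = subst_rule \<theta> \<rho>"
        by (auto simp: instances_def)
      from eq have head: "f = head \<rho>" "ss = map (subst \<theta>) (args \<rho>)" "r = subst \<theta> (rhs \<rho>)"
        "C = (\<lambda>(a, b). (subst \<theta> a, subst \<theta> b)) ` conds \<rho>"
        by (cases \<rho>; simp)+
      have rule: "is_rule \<Sigma> \<rho>" using R \<rho> by (simp add: is_program_def)
      have "sat_rule \<Sigma> A \<rho>" using model \<rho> by (simp add: term_model_def)
      then have "eval \<Sigma> A \<theta> (rhs \<rho>) \<subseteq> A f ss"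
        using \<theta> C head sat_rule_iff[OF A rule] sat_conds_subst[OF \<theta>] by metis
      moreover have "t \<in> eval \<Sigma> A \<theta> (rhs \<rho>)"
        using t head eval_subst[OF \<theta>] by metis
      moreover have "A f ss \<subseteq> A f ts"
        using TAlg_mono[OF A f _ ts le] map_subst_CTuples_bot[OF is_rule_args[OF rule] \<theta>] head
        by simp
      ultimately show ?thesis by blast
    qed
  qed
qed

section \<open>Deletion equivalence, symbol by symbol\<close>

lemma equiv_CM_iff:
  fixes P Q :: "('c, 'f, 'v) rule set"
  assumes "is_program \<Sigma> P" "is_program \<Sigma> Q"
  shows "equiv_CM \<Sigma> P Q \<longleftrightarrow> (\<forall>A\<in>CTAlg \<Sigma>. term_model \<Sigma> P A \<longleftrightarrow> term_model \<Sigma> Q A)"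
proof -
  have "A \<in> TAlg \<Sigma>" if "A \<in> CTAlg \<Sigma>" for A :: "('c, 'f, 'v) interp"
    using that by (simp add: CTAlg_def)
  then show ?thesis
    unfolding equiv_CM_def by (simp add: T_op_le_iff assms)
qed

lemma is_program_delete: "is_program \<Sigma> P \<Longrightarrow> is_program \<Sigma> (delete P \<sigma>)"
  by (simp add: is_program_def delete_def)

lemma is_program_head: "is_program \<Sigma> P \<Longrightarrow> \<rho> \<in> P \<Longrightarrow> head \<rho> \<in> FS \<Sigma>"
  by (simp add: is_program_def is_rule_def)

lemma delete_all_but_one:
  assumes "is_program \<Sigma> P" "f \<in> FS \<Sigma>"
  shows "delete P (FS \<Sigma> - {f}) = defining_rules P f"
  using is_program_head[OF assms(1)] assms(2) by (auto simp: delete_def defining_rules_def)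

text \<open>Heads lie in \<open>FS \<Sigma>\<close>, so the surviving rules split according to the
  symbols of \<open>FS \<Sigma> - \<sigma>\<close>. If that set is empty, both sides hold because
  \<open>A\<close> is a term algebra.\<close>

lemma term_model_delete_iff:
  assumes "is_program \<Sigma> P" "A \<in> TAlg \<Sigma>"
  shows "term_model \<Sigma> (delete P \<sigma>) A \<longleftrightarrow>
    (\<forall>f\<in>FS \<Sigma> - \<sigma>. term_model \<Sigma> (defining_rules P f) A)"
  using is_program_head[OF assms(1)] assms(2)
  unfolding term_model_def delete_def defining_rules_def by blast

text \<open>Deleting \<open>FS \<Sigma> - {f}\<close> isolates the rules for \<open>f\<close>.
  Conversely, the consistent models left after any deletion form the intersection, within
  \<open>CTAlg \<Sigma>\<close>, of the classes of the surviving symbols.\<close>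

lemma equiv_D_iff_M_sem:
  assumes P: "is_program \<Sigma> P" and Q: "is_program \<Sigma> Q"
  shows "equiv_D \<Sigma> P Q \<longleftrightarrow> (\<forall>f\<in>FS \<Sigma>. M_sem \<Sigma> f P = M_sem \<Sigma> f Q)"
proof
  assume D: "equiv_D \<Sigma> P Q"
  show "\<forall>f\<in>FS \<Sigma>. M_sem \<Sigma> f P = M_sem \<Sigma> f Q"
  proof
    fix f assume f: "f \<in> FS \<Sigma>"
    have "equiv_CM \<Sigma> (delete P (FS \<Sigma> - {f})) (delete Q (FS \<Sigma> - {f}))"
      using D by (auto simp: equiv_D_def)
    then have "\<forall>A\<in>CTAlg \<Sigma>. term_model \<Sigma> (defining_rules P f) A \<longleftrightarrow>
        term_model \<Sigma> (defining_rules Q f) A"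
      unfolding equiv_CM_iff[OF is_program_delete[OF P] is_program_delete[OF Q]]
      by (simp add: delete_all_but_one[OF P f] delete_all_but_one[OF Q f])
    then show "M_sem \<Sigma> f P = M_sem \<Sigma> f Q"
      by (auto simp: M_sem_def)
  qed
next
  assume M: "\<forall>f\<in>FS \<Sigma>. M_sem \<Sigma> f P = M_sem \<Sigma> f Q"
  have "term_model \<Sigma> (defining_rules P f) A \<longleftrightarrow> term_model \<Sigma> (defining_rules Q f) A"
    if "f \<in> FS \<Sigma>" "A \<in> CTAlg \<Sigma>" for f A
    using M that by (auto simp: M_sem_def set_eq_iff)
  then show "equiv_D \<Sigma> P Q"
    unfolding equiv_D_def equiv_CM_iff[OF is_program_delete[OF P] is_program_delete[OF Q]]
    by (simp add: CTAlg_def term_model_delete_iff[OF P] term_model_delete_iff[OF Q])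
qed

section \<open>Enlarging one symbol to the whole carrier\<close>

definition maximize :: "('c, 'f) signature \<Rightarrow> 'f \<Rightarrow> ('c, 'f, 'v) interp \<Rightarrow> ('c, 'f, 'v) interp"
  where "maximize \<Sigma> f A =
    A(f := (\<lambda>ts. if ts \<in> CTuples_bot \<Sigma> (fun_arity \<Sigma> f) then CTerm_bot \<Sigma> else {}))"

text \<open>The conditions on a consistent term algebra concern each symbol separately. For
  \<open>f\<close>, the carrier is a cone closed under substitution, a constant map is monotonic,
  and \<open>{}\<close> is the value prescribed off the domain.\<close>

lemma maximize_CTAlg:
  fixes A :: "('c, 'f, 'v) interp"
  assumes A: "A \<in> CTAlg \<Sigma>" and f: "f \<in> FS \<Sigma>"
  shows "maximize \<Sigma> f A \<in> CTAlg \<Sigma>"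
proof -
  have T: "A \<in> TAlg \<Sigma>" and cons: "consistent \<Sigma> A"
    using A by (auto simp: CTAlg_def)
  have "is_cone \<Sigma> (CTerm_bot \<Sigma>)"
    using Bot_CTerm_bot unfolding is_cone_def by blast
  then have "maximize \<Sigma> f A \<in> TAlg \<Sigma>"
    using T f unfolding TAlg_def maximize_def by auto
  moreover have "consistent \<Sigma> (maximize \<Sigma> f A)"
    unfolding consistent_def
  proof (intro ballI)
    fix g and ts :: "('c, 'f, 'v) trm list" and \<theta> :: "'v \<Rightarrow> ('c, 'f, 'v) trm"
    assume g: "g \<in> FS \<Sigma>" and ts: "ts \<in> CTuples_bot \<Sigma> (fun_arity \<Sigma> g)"
      and \<theta>: "\<theta> \<in> CSubst \<Sigma>"
    then have "\<theta> \<in> CSubst_bot \<Sigma>" using CSubst_subset_CSubst_bot by blast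
    with g ts \<theta> cons
    show "{subst \<theta> u | u. u \<in> maximize \<Sigma> f A g ts} \<subseteq> maximize \<Sigma> f A g (map (subst \<theta>) ts)"
      by (cases "g = f") (auto simp: maximize_def consistent_def map_subst_CTuples_bot
          intro: subst_CTerm_bot)
  qed
  ultimately show ?thesis by (simp add: CTAlg_def)
qed

lemma maximize_ge:
  assumes "A \<in> TAlg \<Sigma>"
  shows "A g ts \<subseteq> maximize \<Sigma> f A g ts"
  using TAlg_subset_CTerm_bot[OF assms] TAlg_outside[OF assms, of f ts]
  by (auto simp: maximize_def)

text \<open>The left-hand side of a rule for \<open>f\<close> now evaluates to the whole carrier,
  which contains every value of a right-hand side.\<close>

lemma maximize_M_sem:
  assumes A: "A \<in> CTAlg \<Sigma>" and f: "f \<in> FS \<Sigma>" and P: "is_program \<Sigma> P"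
  shows "maximize \<Sigma> f A \<in> M_sem \<Sigma> f P"
proof -
  let ?B = "maximize \<Sigma> f A"
  have B: "?B \<in> CTAlg \<Sigma>" using maximize_CTAlg[OF A f] .
  then have T: "?B \<in> TAlg \<Sigma>" by (simp add: CTAlg_def)
  have "sat_rule \<Sigma> ?B \<rho>" if "\<rho> \<in> P" "head \<rho> = f" for \<rho>
  proof -
    have rule: "is_rule \<Sigma> \<rho>" using P that by (simp add: is_program_def)
    have "?B (head \<rho>) (map (subst \<eta>) (args \<rho>)) = CTerm_bot \<Sigma>" if "\<eta> \<in> CSubst_bot \<Sigma>" for \<eta>
      using map_subst_CTuples_bot[OF is_rule_args[OF rule] that] \<open>head \<rho> = f\<close>
      by (simp add: maximize_def)
    then show ?thesis
      unfolding sat_rule_iff[OF T rule] using eval_subset_CTerm_bot[OF T] by metis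
  qed
  with B T show ?thesis
    unfolding M_sem_def term_model_def defining_rules_def by blast
qed

text \<open>Passing from \<open>A\<close> to \<open>?B\<close> preserves the conditions and enlarges
  right-hand sides, while \<open>g\<close> keeps its interpretation. The lower bound on
  \<open>g\<close> in \<open>?B\<close> is therefore at least as strong as the one in
  \<open>A\<close>.\<close>

lemma maximize_M_sem_other:
  assumes A: "A \<in> CTAlg \<Sigma>" and Q: "is_program \<Sigma> Q" and "f \<noteq> g"
    and M: "maximize \<Sigma> f A \<in> M_sem \<Sigma> g Q"
  shows "A \<in> M_sem \<Sigma> g Q"
proof -
  let ?B = "maximize \<Sigma> f A"
  have T: "A \<in> TAlg \<Sigma>" using A by (simp add: CTAlg_def)
  have B: "?B \<in> TAlg \<Sigma>" using M by (simp add: M_sem_def CTAlg_def)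
  have "sat_rule \<Sigma> A \<rho>" if "\<rho> \<in> Q" "head \<rho> = g" for \<rho>
  proof -
    have rule: "is_rule \<Sigma> \<rho>" using Q that by (simp add: is_program_def)
    have sat: "sat_rule \<Sigma> ?B \<rho>"
      using M that by (simp add: M_sem_def term_model_def defining_rules_def)
    have "eval \<Sigma> A \<eta> (rhs \<rho>) \<subseteq> A (head \<rho>) (map (subst \<eta>) (args \<rho>))"
      if \<eta>: "\<eta> \<in> CSubst_bot \<Sigma>" and C: "sat_conds \<Sigma> A \<eta> (conds \<rho>)" for \<eta>
    proof -
      have "eval \<Sigma> A \<eta> (rhs \<rho>) \<subseteq> eval \<Sigma> ?B \<eta> (rhs \<rho>)"
        by (intro eval_mono maximize_ge T)
      also have "\<dots> \<subseteq> ?B (head \<rho>) (map (subst \<eta>) (args \<rho>))"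
        using sat \<eta> sat_conds_mono[of A ?B, OF maximize_ge[OF T] C]
        by (simp add: sat_rule_iff[OF B rule])
      also have "\<dots> = A (head \<rho>) (map (subst \<eta>) (args \<rho>))"
        using \<open>f \<noteq> g\<close> \<open>head \<rho> = g\<close> by (simp add: maximize_def)
      finally show ?thesis .
    qed
    then show ?thesis by (simp add: sat_rule_iff[OF T rule])
  qed
  with A T show ?thesis
    unfolding M_sem_def term_model_def defining_rules_def by blast
qed

text \<open>Two programs appear because equal deletion semantics match a class of one module with a
  class of the other, possibly at a different symbol.\<close>

lemma M_sem_eq_CTAlg:
  fixes P Q :: "('c, 'f, 'v) rule set"
  assumes "is_program \<Sigma> P" "is_program \<Sigma> Q" "f \<in> FS \<Sigma>" "f \<noteq> g"
    and "M_sem \<Sigma> f P = M_sem \<Sigma> g Q"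
  shows "M_sem \<Sigma> g Q = CTAlg \<Sigma>"
proof
  show "M_sem \<Sigma> g Q \<subseteq> CTAlg \<Sigma>" by (auto simp: M_sem_def)
  show "CTAlg \<Sigma> \<subseteq> M_sem \<Sigma> g Q"
  proof
    fix A :: "('c, 'f, 'v) interp"
    assume A: "A \<in> CTAlg \<Sigma>"
    have "maximize \<Sigma> f A \<in> M_sem \<Sigma> g Q"
      using maximize_M_sem[OF A assms(3,1)] assms(5) by simp
    then show "A \<in> M_sem \<Sigma> g Q"
      by (rule maximize_M_sem_other[OF A assms(2,4)])
  qed
qed

section \<open>Recovering the indexed family from the set of model classes\<close>

lemma deletion_semantics_eq_iff:
  assumes P: "is_program \<Sigma> P" and Q: "is_program \<Sigma> Q"
  shows "deletion_semantics \<Sigma> P = deletion_semantics \<Sigma> Q \<longleftrightarrow>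
    (\<forall>f\<in>FS \<Sigma>. M_sem \<Sigma> f P = M_sem \<Sigma> f Q)"
proof
  assume eq: "deletion_semantics \<Sigma> P = deletion_semantics \<Sigma> Q"
  show "\<forall>f\<in>FS \<Sigma>. M_sem \<Sigma> f P = M_sem \<Sigma> f Q"
  proof
    fix f assume f: "f \<in> FS \<Sigma>"
    from eq f have "M_sem \<Sigma> f P \<in> deletion_semantics \<Sigma> Q" "M_sem \<Sigma> f Q \<in> deletion_semantics \<Sigma> P"
      by (auto simp: deletion_semantics_def)
    \<comment> \<open>Equality of the sets only yields partners at unknown symbols: \<open>g\<close>
      for the class of \<open>f\<close> in \<open>P\<close>, and \<open>h\<close> for the class of
      \<open>f\<close> in \<open>Q\<close>.\<close>
    then obtain g h where g: "g \<in> FS \<Sigma>" "M_sem \<Sigma> f P = M_sem \<Sigma> g Q"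
      and h: "h \<in> FS \<Sigma>" "M_sem \<Sigma> f Q = M_sem \<Sigma> h P"
      unfolding deletion_semantics_def by blast
    show "M_sem \<Sigma> f P = M_sem \<Sigma> f Q"
    proof (cases "f = g \<or> f = h")
      case True
      with g h show ?thesis by auto
    next
      case False
      \<comment> \<open>Both partners belong to symbols other than \<open>f\<close>, so each of the
        two classes of \<open>f\<close> is all of \<open>CTAlg \<Sigma>\<close>.\<close>
      then show ?thesis
        using M_sem_eq_CTAlg[OF P Q f _ g(2)] M_sem_eq_CTAlg[OF Q P f _ h(2)] g h by simp
    qed
  qed
next
  assume "\<forall>f\<in>FS \<Sigma>. M_sem \<Sigma> f P = M_sem \<Sigma> f Q"
  then show "deletion_semantics \<Sigma> P = deletion_semantics \<Sigma> Q"
    unfolding deletion_semantics_def by auto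
qed

theorem proposition7p5:
  fixes \<Sigma> :: "('c, 'f) signature"
    and P Q :: "('c, 'f, 'v::countable) rule set"
  assumes "is_signature \<Sigma>" and "is_module \<Sigma> P" and "is_module \<Sigma> Q"
  shows "equiv_D \<Sigma> P Q \<longleftrightarrow> deletion_semantics \<Sigma> P = deletion_semantics \<Sigma> Q"
  using assms(2,3) equiv_D_iff_M_sem deletion_semantics_eq_iff
  unfolding is_module_def by blast

end
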